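(* Let $a>1$ be an integer and $n$ an overpseudoprime to base $a$. Then for any two divisors $d_1<d_2$ of $n$ (including $1$ and $n$), $h_a(n)$ divides $d_2-d_1$.
   Context: For an integer $m>1$ with $\gcd(m,a)=1$, $h_a(m)$ denotes the multiplicative order of $a$ modulo $m$. The cyclotomic cosets of $a$ modulo $m$ are the orbits of $\{1,2,\ldots,m-1\}$ under $x\mapsto ax\bmod m$; $r_a(m)$ denotes their number. An odd composite number $n$ with $\gcd(n,a)=1$ is called an overpseudoprime to base $a$ if $n=r_a(n)h_a(n)+1$. *)

theory Defs
  imports "HOL-Number_Theory.Number_Theory" "HOL-Combinatorics.Orbits"
begin

text \<open>
  For \<open>m\<close> coprime to \<open>a\<close> the map \<open>x \<mapsto> a x mod m\<close> permutes
  \<open>{1..<m}\<close>, so \<^const>\<open>orbit\<close>, which in general collects only the iterates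
  with positive exponent, contains the starting point here.
\<close>

definition cyclotomic_cosets :: "nat \<Rightarrow> nat \<Rightarrow> nat set set" where
  "cyclotomic_cosets a m = orbit (\<lambda>x. a * x mod m) ` {1..<m}"

definition num_cyclotomic_cosets :: "nat \<Rightarrow> nat \<Rightarrow> nat" where
  "num_cyclotomic_cosets a m = card (cyclotomic_cosets a m)"

text \<open>Argument order: \<open>ord m a\<close> is the order of \<open>a\<close> modulo \<open>m\<close>.\<close>

definition overpseudoprime :: "nat \<Rightarrow> nat \<Rightarrow> bool" where
  "overpseudoprime a n \<longleftrightarrow>
     odd n \<and> n > 1 \<and> \<not> prime n \<and> coprime n a \<and>
     n = num_cyclotomic_cosets a n * ord n a + 1"

end

theory Submission
  imports Defs
begin

text \<open>
  Every coset has at most \<open>h = ord n a\<close> elements, so \<open>n - 1 = r h\<close> forces every coset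
  to have exactly \<open>h\<close> elements. The coset of \<open>n div p\<close>, for a prime \<open>p\<close> dividing \<open>n\<close>,
  has at most \<open>ord p a\<close> elements, hence \<open>h = ord p a\<close>, which divides \<open>p - 1\<close>.
  So all prime factors of \<open>n\<close>, and with them all divisors of \<open>n\<close>, are \<open>1\<close> modulo \<open>h\<close>.
\<close>

lemma funpow_mult_mod:
  fixes a m x :: nat
  assumes "x < m"
  shows "((\<lambda>x. a * x mod m) ^^ k) x = a ^ k * x mod m"
  using assms by (induction k) (simp_all add: mod_mult_right_eq mult.assoc)

text \<open>Exponents can be reduced modulo \<open>t\<close>, so the first \<open>t\<close> iterates
  exhaust the orbit. Any positive period serves, minimal or not.\<close>

lemma finite_orbit_card_le_period:
  assumes "(f ^^ t) x = x" and "t > 0"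
  shows "finite (orbit f x)" and "card (orbit f x) \<le> t"
proof -
  have sub: "orbit f x \<subseteq> (\<lambda>k. (f ^^ k) x) ` {..<t}"
  proof
    fix y
    assume "y \<in> orbit f x"
    then obtain k where "y = (f ^^ k) x"
      by (auto simp: orbit_altdef)
    then have "y = (f ^^ (k mod t)) x"
      using funpow_mod_eq[OF assms(1)] by simp
    then show "y \<in> (\<lambda>k. (f ^^ k) x) ` {..<t}"
      using assms(2) by simp
  qed
  then show "finite (orbit f x)"
    by (rule finite_subset) simp
  have "card (orbit f x) \<le> card ((\<lambda>k. (f ^^ k) x) ` {..<t})"
    using sub by (intro card_mono) auto
  also have "\<dots> \<le> t"
    using card_image_le[of "{..<t}" "\<lambda>k. (f ^^ k) x"] by simp
  finally show "card (orbit f x) \<le> t" .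
qed

lemma ord_eq_ord_prime_divisor:
  fixes a n p :: nat
  assumes over: "overpseudoprime a n" and p: "prime p" "p dvd n"
  shows "ord p a = ord n a"
proof -
  define f where "f = (\<lambda>x. a * x mod n)"
  define h where "h = ord n a"
  define t where "t = ord p a"
  define C where "C = orbit f ` {1..<n}"
  have n: "n > 1" "coprime n a" and card_eq: "n = card C * h + 1"
    using over
    by (auto simp: overpseudoprime_def num_cyclotomic_cosets_def cyclotomic_cosets_def
        C_def f_def h_def)
  have "coprime p a"
    using n p(2) coprime_divisors[of p n a a] by simp
  \<comment> \<open>\<open>ord\<close> takes the default value 0 only when coprimality
    fails.\<close>
  then have pos: "h > 0" "t > 0"
    using n by (simp_all add: h_def t_def)
  have per: "(f ^^ h) x = x" if "x < n" for x
  proof -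
    have "[a ^ h * x = 1 * x] (mod n)"
      unfolding h_def by (intro cong_mult ord cong_refl)
    then show ?thesis
      using that by (simp add: f_def funpow_mult_mod cong_def)
  qed
  have card_le: "finite c \<and> card c \<le> h" if "c \<in> C" for c
    using that finite_orbit_card_le_period[OF per] pos(1) by (auto simp: C_def)
  define x where "x = n div p"
  have n_eq: "n = p * x"
    using p(2) by (simp add: x_def)
  have x: "x \<in> {1..<n}"
    using n_eq n(1) prime_gt_1_nat[OF p(1)] by (cases "x = 0") auto
  \<comment> \<open>Scaling \<open>a ^ t = 1\<close> modulo \<open>p\<close> by \<open>x\<close>
    lifts it to the modulus \<open>p * x = n\<close>, so \<open>t\<close> is a period at
    \<open>x\<close>.\<close>
  have "[a ^ t * x = 1 * x] (mod p * x)"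
    unfolding cong_def mod_mult_mult2 using ord[of a p] by (simp add: t_def cong_def)
  then have "(f ^^ t) x = x"
    using x by (simp add: f_def funpow_mult_mod cong_def n_eq[symmetric])
  then have x_le: "card (orbit f x) \<le> t"
    using finite_orbit_card_le_period(2) pos(2) by metis
  have xC: "orbit f x \<in> C"
    using x by (simp add: C_def)
  have "h \<le> t"
  proof (rule ccontr)
    assume "\<not> h \<le> t"
    then have lt: "card (orbit f x) < h"
      using x_le by simp
    have finC: "finite C"
      by (simp add: C_def)
    have "{1..<n} \<subseteq> \<Union>C"
    proof
      fix y
      assume y: "y \<in> {1..<n}"
      \<comment> \<open>\<open>orbit\<close> starts at exponent 1, so \<open>y\<close> is recovered
        as its own \<open>h\<close>-th iterate.\<close>
      then have "y \<in> orbit f y"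
        using per[of y] pos(1) by (auto simp: orbit_altdef intro!: exI[of _ h])
      then show "y \<in> \<Union>C"
        using y by (auto simp: C_def)
    qed
    \<comment> \<open>With one coset shorter than \<open>h\<close>, the union bound gives fewer than
      \<open>card C * h = n - 1\<close> elements.\<close>
    then have "n - 1 \<le> card (\<Union>C)"
      using finC card_le card_mono[of "\<Union>C" "{1..<n}"] by auto
    also have "\<dots> \<le> sum card C"
      by (rule card_Union_le_sum_card)
    also have "\<dots> < (\<Sum>c\<in>C. h)"
      using finC card_le xC lt by (intro sum_strict_mono_ex1) auto
    finally show False
      using card_eq by simp
  qed
  \<comment> \<open>The congruence \<open>a ^ h = 1\<close> modulo \<open>n\<close> descends to its
    divisor \<open>p\<close>.\<close>
  moreover have "t dvd h"
    unfolding t_def ord_divides[symmetric] h_def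
    using ord[of a n] p(2) by (rule cong_dvd_modulus_nat)
  ultimately show ?thesis
    using pos(1) dvd_imp_le[of t h] by (simp add: h_def t_def)
qed

text \<open>The class of 1 is closed under products, and \<open>d\<close> is the product of its
  prime powers.\<close>

lemma cong_1_if_prime_divisors_cong_1:
  fixes d h :: nat
  assumes "d > 0" and "\<And>p. prime p \<Longrightarrow> p dvd d \<Longrightarrow> [p = 1] (mod h)"
  shows "[d = 1] (mod h)"
proof -
  have "[(\<Prod>p\<in>prime_factors d. p ^ multiplicity p d) = (\<Prod>p\<in>prime_factors d. 1)] (mod h)"
  proof (rule cong_prod)
    fix p
    assume "p \<in> prime_factors d"
    then have "[p = 1] (mod h)"
      using assms(2) by auto
    then show "[p ^ multiplicity p d = 1] (mod h)"
      using cong_pow[of p 1 h "multiplicity p d"] by simp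
  qed
  then show ?thesis
    unfolding prime_factorization_nat[OF assms(1), symmetric] by simp
qed

theorem theorem14:
  fixes a n d1 d2 :: nat
  assumes "a > 1"
    and "overpseudoprime a n"
    and "d1 dvd n" and "d2 dvd n" and "d1 < d2"
  shows "ord n a dvd d2 - d1"
proof -
  have n: "n > 0" "coprime n a"
    using assms(2) by (auto simp: overpseudoprime_def)
  have prime_cong: "[p = 1] (mod ord n a)" if p: "prime p" "p dvd n" for p
  proof -
    have "coprime p a"
      using n p(2) coprime_divisors[of p n a a] by simp
    \<comment> \<open>Fermat's little theorem, as \<open>totient p = p - 1\<close>.\<close>
    then have "ord p a dvd p - 1"
      using order_divides_totient[of p a] p(1) by (simp add: totient_prime)
    then show ?thesis
      using ord_eq_ord_prime_divisor[OF assms(2) p] prime_gt_1_nat[OF p(1)]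
      by (simp add: cong_altdef_nat)
  qed
  have div_cong: "[d = 1] (mod ord n a)" if d: "d dvd n" for d
  proof (rule cong_1_if_prime_divisors_cong_1)
    show "d > 0"
      using d n(1) by (rule dvd_pos_nat[rotated])
  next
    fix p
    assume "prime p" "p dvd d"
    then show "[p = 1] (mod ord n a)"
      using prime_cong dvd_trans[OF _ d] by simp
  qed
  have "[d2 = d1] (mod ord n a)"
    using cong_trans[OF div_cong[OF assms(4)] cong_sym[OF div_cong[OF assms(3)]]] .
  then show ?thesis
    using assms(5) by (simp add: cong_altdef_nat)
qed

end
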